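(* Let $(x_k)_{k\ge0}$ be generated by algorithm CPG or CGD (see context) under the assumptions stated there, with $i_k$ chosen uniformly at random, and assume that for some constant $C>0$, $$F(x_k)-\mathbb{E}[F(x_{k+1})\mid x_k]\ge C\|\nabla F(x_k)\|^2\qquad\forall k\ge0 .$$ Then for every $k\ge1$, $$\min_{0\le i\le k-1}\mathbb{E}\big[\|\nabla F(x_i)\|^2\big]\le\frac{F(x_0)-F^*}{kC}.$$
   Context: Setting: $F=f+\psi$ with $f,\psi:\mathbb{R}^n\to\mathbb{R}$, $f$ differentiable, both possibly nonconvex; $F^*=\min F$. $U=[U_1,\dots,U_N]\in\mathbb{R}^{n\times n}$ is a column permutation of $I_n$, split into $U_i\in\mathbb{R}^{n\times n_i}$, $\sum_i n_i=n$. Norms are Euclidean / induced operator norms. The $i_k$ are independent, each uniform on $\{1,\dots,N\}$ and independent of the past; $x_0$ is deterministic. Assumptions. A.1: $\|U_i^T(\nabla f(x+U_ih)-\nabla f(x))\|\le L_i\|h\|$ for all $h,x,i$. A.2: $\psi$ is twice continuously differentiable. A.3: $F$ attains its minimum $F^*>-\infty$. Algorithm CPG: fix $\eta_i>0$; $H_{f,U_i}=\frac{L_i+\eta_i}{2}$ if $d\mapsto\psi(x+U_id)$ is convex for all $x,i$, else $H_{f,U_i}=L_i+\eta_i$. Given $x_0$, for $k\ge0$: choose $i_k$; take $d_k\in\arg\min_{d\in\mathbb{R}^{n_{i_k}}}f(x_k)+\langle U_{i_k}^T\nabla f(x_k),d\rangle+\frac{H_{f,U_{i_k}}}{2}\|d\|^2+\psi(x_k+U_{i_k}d)$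 (assumed to exist); $x_{k+1}=x_k+U_{i_k}d_k$. Algorithm CGD: fix $\eta_i>0$; $H_{f,U_i}=\frac{L_i+\eta_i}{2}$. Given $x_0$, for $k\ge0$: choose $i_k$, compute $H_{F_k}$ by one of the rules below, $d_k=-\frac1{H_{F_k}}U_{i_k}^T\nabla F(x_k)$, $x_{k+1}=x_k+U_{i_k}d_k$. The same rule is used for all $k$, and $\psi$ satisfies the assumption attached to it: Rule 1 (A.4 and A.5): $\alpha_k\ge0$ root of $\frac{L_\psi}{6}\alpha^2+(\frac{H_\psi}{2}\|x_k\|^p+H_{f,U_{i_k}})\alpha=\|U_{i_k}^T\nabla F(x_k)\|$; $H_{F_k}=\frac{H_\psi}{2}\|x_k\|^p+\frac{L_\psi}{6}\alpha_k+H_{f,U_{i_k}}$. Rule 2 (A.4): $\alpha_k\ge0$ root of $2^{p-1}H_\psi\alpha^{p+1}+(2^{p-1}H_\psi\|x_k\|^p+H_{f,U_{i_k}})\alpha=\|U_{i_k}^T\nabla F(x_k)\|$; $H_{F_k}=2^{p-1}H_\psi\|x_k\|^p+2^{p-1}H_\psi\alpha_k^p+H_{f,U_{i_k}}$. Rule 3 (A.5): $\alpha_k\ge0$ root of $\frac{L_\psi}{6}\alpha^2+(\frac{L_\psi}{2}\|x_k-x_0\|+\frac12\|\nabla^2\psi(x_0)\|+H_{f,U_{i_k}})\alpha=\|U_{i_k}^T\nabla F(x_k)\|$; $H_{F_k}=\frac{L_\psi}{2}\|x_k-x_0\|+\frac12\|\nabla^2\psi(x_0)\|+\frac{L_\psi}{6}\alpha_k+H_{f,U_{i_k}}$.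 Rule 4 (A.6): $H_{F_k}=H_{f,U_{i_k}}$. Here A.4: $\|U_i^T\nabla^2\psi(y)U_i\|\le H_\psi\|y\|^p$ for all $y,i$ ($H_\psi>0$, integer $p\ge1$); A.5: $\|\nabla^2\psi(y)-\nabla^2\psi(x)\|\le L_\psi\|y-x\|$ for all $x,y$ ($L_\psi>0$); A.6: $\psi(x+U_id)\le\psi(x)+\langle U_i^T\nabla\psi(x),d\rangle$ for all $x,d,i$. *)

theory Defs
  imports "HOL-Probability.Probability"
begin

definition grad :: "('a::real_inner \<Rightarrow> real) \<Rightarrow> 'a \<Rightarrow> 'a" where
  "grad f x = (THE D. GDERIV f x :> D)"

definition hess :: "(real^'n \<Rightarrow> real) \<Rightarrow> real^'n \<Rightarrow> real^'n^'n" where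
  "hess f x = jacobian (grad f) (at x)"

definition twice_cont_differentiable :: "(real^'n \<Rightarrow> real) \<Rightarrow> bool" where
  "twice_cont_differentiable f \<longleftrightarrow>
     (\<forall>x. f differentiable (at x)) \<and> (\<forall>x. grad f differentiable (at x)) \<and>
     continuous_on UNIV (hess f)"

(* The induced Euclidean norm; the norm of the type real^'n^'n itself is the Frobenius norm. *)
definition op_norm :: "real^'n^'n \<Rightarrow> real" where
  "op_norm A = onorm ((*v) A)"

text \<open>
  Block structure. The columns of \<open>U\<close> are indexed by \<open>'n\<close>, and \<open>b c\<close> is the number of the block
  that contains column \<open>c\<close>. Since the block widths \<open>n\<^sub>i\<close> vary with \<open>i\<close>, the space of vectors indexed
  by the columns of block \<open>i\<close> is embedded into \<open>real^'n\<close> by zero padding (\<open>block_space\<close>), and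
  \<open>U\<^sub>i\<close> is padded with zero columns (\<open>block\<close>). Matrix-vector products, inner products, Euclidean
  norms and induced operator norms are those of the unpadded objects.
\<close>

definition column_permutation_of_id :: "real^'n^'n \<Rightarrow> bool" where
  "column_permutation_of_id U \<longleftrightarrow>
     (\<exists>\<pi>. \<pi> permutes UNIV \<and> U = (\<chi> r c. mat 1 $ r $ \<pi> c))"

definition block_space :: "('n \<Rightarrow> nat) \<Rightarrow> nat \<Rightarrow> (real^'n) set" where
  "block_space b i = {d. \<forall>c. b c \<noteq> i \<longrightarrow> d $ c = 0}"

definition block :: "real^'n^'n \<Rightarrow> ('n \<Rightarrow> nat) \<Rightarrow> nat \<Rightarrow> real^'n^'n" where
  "block U b i = (\<chi> r c. if b c = i then U $ r $ c else 0)"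

definition coord_lipschitz_grad ::
  "real^'n^'n \<Rightarrow> ('n \<Rightarrow> nat) \<Rightarrow> nat \<Rightarrow> (nat \<Rightarrow> real) \<Rightarrow> (real^'n \<Rightarrow> real) \<Rightarrow> bool" where
  "coord_lipschitz_grad U b N L f \<longleftrightarrow>
     (\<forall>i\<in>{1..N}. \<forall>x. \<forall>h\<in>block_space b i.
        norm (transpose (block U b i) *v (grad f (x + block U b i *v h) - grad f x)) \<le> L i * norm h)"

definition A4 ::
  "real^'n^'n \<Rightarrow> ('n \<Rightarrow> nat) \<Rightarrow> nat \<Rightarrow> real \<Rightarrow> nat \<Rightarrow> (real^'n \<Rightarrow> real) \<Rightarrow> bool" where
  "A4 U b N H\<psi> p \<psi> \<longleftrightarrow> H\<psi> > 0 \<and> p \<ge> 1 \<and>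
     (\<forall>i\<in>{1..N}. \<forall>y.
        op_norm (transpose (block U b i) ** hess \<psi> y ** block U b i) \<le> H\<psi> * norm y ^ p)"

definition A5 :: "real \<Rightarrow> (real^'n \<Rightarrow> real) \<Rightarrow> bool" where
  "A5 L\<psi> \<psi> \<longleftrightarrow> L\<psi> > 0 \<and>
     (\<forall>x y. op_norm (hess \<psi> y - hess \<psi> x) \<le> L\<psi> * norm (y - x))"

definition A6 ::
  "real^'n^'n \<Rightarrow> ('n \<Rightarrow> nat) \<Rightarrow> nat \<Rightarrow> (real^'n \<Rightarrow> real) \<Rightarrow> bool" where
  "A6 U b N \<psi> \<longleftrightarrow>
     (\<forall>i\<in>{1..N}. \<forall>x. \<forall>d\<in>block_space b i.
        \<psi> (x + block U b i *v d) \<le> \<psi> x + (transpose (block U b i) *v grad \<psi> x) \<bullet> d)"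

(* The case distinction is global: convexity is required for all x and all blocks at once. *)
definition cpg_H ::
  "real^'n^'n \<Rightarrow> ('n \<Rightarrow> nat) \<Rightarrow> nat \<Rightarrow> (nat \<Rightarrow> real) \<Rightarrow> (nat \<Rightarrow> real) \<Rightarrow> (real^'n \<Rightarrow> real) \<Rightarrow> nat \<Rightarrow> real" where
  "cpg_H U b N L \<eta> \<psi> i =
     (if \<forall>x. \<forall>j\<in>{1..N}. convex_on (block_space b j) (\<lambda>d. \<psi> (x + block U b j *v d))
      then (L i + \<eta> i) / 2 else L i + \<eta> i)"

text \<open>
  In both algorithms \<open>is\<close> and \<open>xs\<close> are one realisation of the index sequence and of the iterates.
\<close>

definition cpg_run ::
  "(real^'n \<Rightarrow> real) \<Rightarrow> (real^'n \<Rightarrow> real) \<Rightarrow> real^'n^'n \<Rightarrow> ('n \<Rightarrow> nat) \<Rightarrow> nat \<Rightarrow>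
   (nat \<Rightarrow> real) \<Rightarrow> (nat \<Rightarrow> real) \<Rightarrow> (nat \<Rightarrow> nat) \<Rightarrow> (nat \<Rightarrow> real^'n) \<Rightarrow> bool" where
  "cpg_run f \<psi> U b N L \<eta> is xs \<longleftrightarrow>
     (\<forall>k. let i = is k; x = xs k; Ui = block U b i in
        \<exists>d. is_arg_min
              (\<lambda>d. f x + (transpose Ui *v grad f x) \<bullet> d
                    + cpg_H U b N L \<eta> \<psi> i / 2 * (norm d)\<^sup>2 + \<psi> (x + Ui *v d))
              (\<lambda>d. d \<in> block_space b i) d \<and>
            xs (Suc k) = x + Ui *v d)"

datatype cgd_rule = Rule1 | Rule2 | Rule3 | Rule4

fun rule_assumption ::
  "cgd_rule \<Rightarrow> real^'n^'n \<Rightarrow> ('n \<Rightarrow> nat) \<Rightarrow> nat \<Rightarrow> real \<Rightarrow> nat \<Rightarrow> real \<Rightarrow> (real^'n \<Rightarrow> real) \<Rightarrow> bool" where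
  "rule_assumption Rule1 U b N H\<psi> p L\<psi> \<psi> \<longleftrightarrow> A4 U b N H\<psi> p \<psi> \<and> A5 L\<psi> \<psi>"
| "rule_assumption Rule2 U b N H\<psi> p L\<psi> \<psi> \<longleftrightarrow> A4 U b N H\<psi> p \<psi>"
| "rule_assumption Rule3 U b N H\<psi> p L\<psi> \<psi> \<longleftrightarrow> A5 L\<psi> \<psi>"
| "rule_assumption Rule4 U b N H\<psi> p L\<psi> \<psi> \<longleftrightarrow> A6 U b N \<psi>"

(* cgd_H rule Hpsi p Lpsi psi x0 x Hf g HF: HF is the value that the rule assigns at the point x,
   where Hf is the constant of the chosen block and g the norm of the block gradient of F at x. *)
fun cgd_H ::
  "cgd_rule \<Rightarrow> real \<Rightarrow> nat \<Rightarrow> real \<Rightarrow> (real^'n \<Rightarrow> real) \<Rightarrow> real^'n \<Rightarrow> real^'n \<Rightarrow> real \<Rightarrow> real \<Rightarrow> real \<Rightarrow> bool" where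
  "cgd_H Rule1 H\<psi> p L\<psi> \<psi> x0 x Hf g HF \<longleftrightarrow>
     (\<exists>\<alpha>\<ge>0. L\<psi> / 6 * \<alpha>\<^sup>2 + (H\<psi> / 2 * norm x ^ p + Hf) * \<alpha> = g \<and>
        HF = H\<psi> / 2 * norm x ^ p + L\<psi> / 6 * \<alpha> + Hf)"
| "cgd_H Rule2 H\<psi> p L\<psi> \<psi> x0 x Hf g HF \<longleftrightarrow>
     (\<exists>\<alpha>\<ge>0. 2 ^ (p - 1) * H\<psi> * \<alpha> ^ (p + 1) + (2 ^ (p - 1) * H\<psi> * norm x ^ p + Hf) * \<alpha> = g \<and>
        HF = 2 ^ (p - 1) * H\<psi> * norm x ^ p + 2 ^ (p - 1) * H\<psi> * \<alpha> ^ p + Hf)"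
| "cgd_H Rule3 H\<psi> p L\<psi> \<psi> x0 x Hf g HF \<longleftrightarrow>
     (\<exists>\<alpha>\<ge>0. L\<psi> / 6 * \<alpha>\<^sup>2
          + (L\<psi> / 2 * norm (x - x0) + 1 / 2 * op_norm (hess \<psi> x0) + Hf) * \<alpha> = g \<and>
        HF = L\<psi> / 2 * norm (x - x0) + 1 / 2 * op_norm (hess \<psi> x0) + L\<psi> / 6 * \<alpha> + Hf)"
| "cgd_H Rule4 H\<psi> p L\<psi> \<psi> x0 x Hf g HF \<longleftrightarrow> HF = Hf"

definition cgd_run ::
  "cgd_rule \<Rightarrow> real \<Rightarrow> nat \<Rightarrow> real \<Rightarrow> (real^'n \<Rightarrow> real) \<Rightarrow> (real^'n \<Rightarrow> real) \<Rightarrow> real^'n^'n \<Rightarrow> ('n \<Rightarrow> nat) \<Rightarrow>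
   (nat \<Rightarrow> real) \<Rightarrow> (nat \<Rightarrow> real) \<Rightarrow> (nat \<Rightarrow> nat) \<Rightarrow> (nat \<Rightarrow> real^'n) \<Rightarrow> bool" where
  "cgd_run rule H\<psi> p L\<psi> f \<psi> U b L \<eta> is xs \<longleftrightarrow>
     (\<forall>k. let i = is k; x = xs k; Ui = block U b i;
              g = transpose Ui *v grad (\<lambda>y. f y + \<psi> y) x in
        \<exists>HF d. cgd_H rule H\<psi> p L\<psi> \<psi> (xs 0) x ((L i + \<eta> i) / 2) (norm g) HF \<and>
            d = - (1 / HF) *\<^sub>R g \<and> xs (Suc k) = x + Ui *v d)"

text \<open>
  The random variables drawn before \<open>i\<^sub>k\<close> are the earlier indices and the iterates
  \<open>x\<^sub>0, \<dots>, x\<^sub>k\<close>. The iterates may depend on more than the indices (for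
  instance through a randomised choice among several minimisers).
\<close>

definition uniform_indices ::
  "'w measure \<Rightarrow> nat \<Rightarrow> (nat \<Rightarrow> 'w \<Rightarrow> nat) \<Rightarrow> (nat \<Rightarrow> 'w \<Rightarrow> real^'n) \<Rightarrow> bool" where
  "uniform_indices M N i x \<longleftrightarrow>
     (\<forall>k. i k \<in> measurable M (count_space {1..N}) \<and>
          distr M (count_space {1..N}) (i k) = uniform_count_measure {1..N}) \<and>
     prob_space.indep_vars M (\<lambda>_. count_space {1..N}) i UNIV \<and>
     (\<forall>k. prob_space.indep_set M
            (sets (vimage_algebra (space M) (i k) (count_space {1..N})))
            (sets (vimage_algebra (space M)
               (\<lambda>\<omega>. (\<lambda>j\<in>{..<k}. i j \<omega>, \<lambda>j\<in>{..k}. x j \<omega>))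
               ((\<Pi>\<^sub>M j\<in>{..<k}. count_space {1..N}) \<Otimes>\<^sub>M (\<Pi>\<^sub>M j\<in>{..k}. borel)))))"

end

(* Every F (x k) is bounded above on the sample space: in CPG because each step decreases F, in CGD
   because the step length is determined by a root of a nonzero polynomial, so that x k ranges over
   a finite set. Bounded below by the minimum of F, F (x k) is then integrable, hence the
   conditional expectations are genuine; integrating the descent inequality and summing over the
   steps telescopes. *)
theory Submission
  imports Defs
begin

section \<open>Gradients: existence, directional derivatives and measurability\<close>

lemma GDERIV_unique:
  assumes "GDERIV f x :> D" "GDERIV f x :> E"
  shows "D = E"
proof -
  have "(\<lambda>h. h \<bullet> D) = (\<lambda>h. h \<bullet> E)"
    using assms unfolding gderiv_def by (rule has_derivative_unique)
  then have "(D - E) \<bullet> D = (D - E) \<bullet> E"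
    by (rule fun_cong)
  then have "(D - E) \<bullet> (D - E) = 0"
    by (simp add: inner_diff_right)
  then show ?thesis by simp
qed

text \<open>Justifies the \<open>THE\<close> in \<open>grad\<close>: on a Euclidean space the
  derivative is a linear functional, represented by its adjoint applied to 1.\<close>

lemma GDERIV_grad:
  fixes f :: "'a::euclidean_space \<Rightarrow> real"
  assumes "f differentiable (at x)"
  shows "GDERIV f x :> grad f x"
proof -
  from assms obtain f' where f': "(f has_derivative f') (at x)"
    by (auto simp: differentiable_def)
  define D where "D = adjoint f' 1"
  have "f' = (\<lambda>h. h \<bullet> D)"
    using adjoint_works[OF has_derivative_linear[OF f'], of _ 1] by (auto simp: D_def fun_eq_iff)
  with f' have D: "GDERIV f x :> D"
    by (simp add: gderiv_def)
  then show ?thesis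
    unfolding grad_def by (rule theI) (rule GDERIV_unique[OF _ D])
qed

lemma GDERIV_line:
  assumes "GDERIV f (x + t *\<^sub>R u) :> D"
  shows "((\<lambda>s. f (x + s *\<^sub>R u)) has_real_derivative D \<bullet> u) (at t)"
proof -
  have line: "((\<lambda>s. x + s *\<^sub>R u) has_derivative (\<lambda>s. s *\<^sub>R u)) (at t)"
    by (auto intro!: derivative_eq_intros)
  have "((\<lambda>s. f (x + s *\<^sub>R u)) has_derivative (\<lambda>s. (s *\<^sub>R u) \<bullet> D)) (at t)"
    using has_derivative_compose[OF line assms[unfolded gderiv_def]] .
  then show ?thesis
    unfolding has_field_derivative_def by (simp add: inner_commute mult_commute_abs)
qed

text \<open>Differentiability alone does not make \<open>grad f\<close> continuous. Each component
  is nevertheless a pointwise limit of difference quotients of the continuous function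
  \<open>f\<close>, hence Borel.\<close>

lemma borel_measurable_grad:
  fixes f :: "'a::euclidean_space \<Rightarrow> real"
  assumes f: "\<And>x. f differentiable (at x)"
  shows "grad f \<in> borel_measurable borel"
proof -
  have [measurable]: "f \<in> borel_measurable borel"
    using f by (intro borel_measurable_continuous_onI)
      (auto simp: continuous_on_eq_continuous_at intro: differentiable_imp_continuous_within)
  have "(\<lambda>x. grad f x \<bullet> u) \<in> borel_measurable borel" for u
  proof (rule borel_measurable_LIMSEQ_real)
    fix x :: 'a
    have "((\<lambda>t. f (x + t *\<^sub>R u)) has_real_derivative grad f x \<bullet> u) (at 0)"
      using GDERIV_grad[OF f] by (intro GDERIV_line) simp
    then have "((\<lambda>t. (f (x + t *\<^sub>R u) - f x) / t) \<longlongrightarrow> grad f x \<bullet> u) (at 0)"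
      by (simp add: DERIV_def)
    \<comment> \<open>The \<open>Suc\<close> keeps every step size nonzero, so the sequence stays in
      the punctured neighbourhoods of 0.\<close>
    moreover have "filterlim (\<lambda>n. inverse (real (Suc n))) (at 0) sequentially"
      unfolding filterlim_at using LIMSEQ_inverse_real_of_nat by auto
    ultimately show "(\<lambda>n. (f (x + inverse (real (Suc n)) *\<^sub>R u) - f x) / inverse (real (Suc n)))
        \<longlonglongrightarrow> grad f x \<bullet> u"
      by (rule filterlim_compose)
  qed measurable
  then show ?thesis
    by (subst borel_measurable_euclidean_space) auto
qed

section \<open>Monotonicity of \<open>F\<close> along every CPG run\<close>

lemma inner_transpose_mult:
  fixes A :: "real^'n^'m"
  shows "(transpose A *v x) \<bullet> y = x \<bullet> (A *v y)"
  by (metis dot_lmul_matrix transpose_matrix_vector)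

lemma block_space_scaleR: "d \<in> block_space b i \<Longrightarrow> t *\<^sub>R d \<in> block_space b i"
  by (simp add: block_space_def)

lemma zero_in_block_space: "0 \<in> block_space b i"
  by (simp add: block_space_def)

text \<open>The descent lemma restricted to one block. It follows from the sign of a derivative
  along the segment rather than from integrating the gradient, so continuity of the gradient never
  enters.\<close>

lemma block_descent:
  fixes f :: "real^'n \<Rightarrow> real"
  assumes f: "\<And>y. f differentiable (at y)"
    and lip: "coord_lipschitz_grad U b N L f"
    and i: "i \<in> {1..N}" and d: "d \<in> block_space b i"
  shows "f (x + block U b i *v d)
    \<le> f x + (transpose (block U b i) *v grad f x) \<bullet> d + L i / 2 * (norm d)\<^sup>2"
proof -
  let ?A = "block U b i"
  \<comment> \<open>The value of \<open>f\<close> on the segment minus the non-constant terms of the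
    quadratic upper model; the claim is exactly \<open>\<phi> 1 \<le> \<phi> 0\<close>.\<close>
  define \<phi> where "\<phi> t = f (x + t *\<^sub>R (?A *v d)) - t * (grad f x \<bullet> (?A *v d))
    - L i / 2 * t\<^sup>2 * (norm d)\<^sup>2" for t
  define \<phi>' where "\<phi>' t = grad f (x + t *\<^sub>R (?A *v d)) \<bullet> (?A *v d) - grad f x \<bullet> (?A *v d)
    - L i * t * (norm d)\<^sup>2" for t
  have deriv: "(\<phi> has_real_derivative \<phi>' t) (at t)" for t
  proof -
    have "((\<lambda>t. f (x + t *\<^sub>R (?A *v d))) has_real_derivative
        grad f (x + t *\<^sub>R (?A *v d)) \<bullet> (?A *v d)) (at t)"
      by (intro GDERIV_line GDERIV_grad f)
    then show ?thesis
      unfolding \<phi>_def[abs_def] \<phi>'_def by (auto intro!: derivative_eq_intros)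
  qed
  have nonpos: "\<phi>' t \<le> 0" if "t \<ge> 0" for t
  proof -
    let ?g = "grad f (x + t *\<^sub>R (?A *v d)) - grad f x"
    have "?g \<bullet> (?A *v d) = (transpose ?A *v ?g) \<bullet> d"
      by (rule inner_transpose_mult[symmetric])
    also have "\<dots> \<le> norm (transpose ?A *v ?g) * norm d"
      by (rule norm_cauchy_schwarz)
    \<comment> \<open>A.1 is applied to the scaled increment \<open>t *\<^sub>R d\<close>, which
      stays in the block space.\<close>
    also have "\<dots> \<le> (L i * norm (t *\<^sub>R d)) * norm d"
    proof (rule mult_right_mono)
      have "norm (transpose ?A *v (grad f (x + ?A *v (t *\<^sub>R d)) - grad f x)) \<le> L i * norm (t *\<^sub>R d)"
        using lip i block_space_scaleR[OF d] unfolding coord_lipschitz_grad_def by blast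
      then show "norm (transpose ?A *v ?g) \<le> L i * norm (t *\<^sub>R d)"
        by (simp add: matrix_vector_mult_scaleR)
    qed simp
    finally show ?thesis
      using that by (simp add: \<phi>'_def inner_diff_left power2_eq_square algebra_simps)
  qed
  have "\<phi> 1 \<le> \<phi> 0"
    by (rule DERIV_nonpos_imp_nonincreasing) (use deriv nonpos in force)+
  then show ?thesis
    by (simp add: \<phi>_def inner_transpose_mult del: transpose_matrix_vector)
qed

text \<open>Comparing the minimiser with 0 would give only \<open>H / 2\<close> in front of the
  squared norm. Convexity allows a comparison with \<open>(1 - t) *\<^sub>R d\<close> as
  \<open>t\<close> tends to 0, which doubles this gain; hence CPG can halve its constant when
  \<open>\<psi>\<close> is convex along blocks.\<close>

lemma convex_prox_step:
  fixes \<phi> :: "'a::real_inner \<Rightarrow> real"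
  assumes convex: "convex_on S \<phi>" and d: "d \<in> S" and zero: "0 \<in> S"
    and min: "\<And>e. e \<in> S \<Longrightarrow> g \<bullet> d + H / 2 * (norm d)\<^sup>2 + \<phi> d \<le> g \<bullet> e + H / 2 * (norm e)\<^sup>2 + \<phi> e"
  shows "g \<bullet> d + H * (norm d)\<^sup>2 + \<phi> d \<le> \<phi> 0"
proof -
  \<comment> \<open>The factor \<open>2 - t\<close> is what remains of
    \<open>1 - (1 - t)\<^sup>2\<close> after division by \<open>t\<close>.\<close>
  have *: "g \<bullet> d + (2 - t) * (H / 2 * (norm d)\<^sup>2) + \<phi> d \<le> \<phi> 0" if t: "0 < t" "t < 1" for t
  proof -
    have "(1 - t) *\<^sub>R d \<in> S"
      using convexD_alt[OF convex_on_imp_convex[OF convex] d zero, of t] t by simp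
    then have "g \<bullet> d + H / 2 * (norm d)\<^sup>2 + \<phi> d
        \<le> (1 - t) * (g \<bullet> d) + (1 - t)\<^sup>2 * (H / 2 * (norm d)\<^sup>2) + \<phi> ((1 - t) *\<^sub>R d)"
      using min[of "(1 - t) *\<^sub>R d"] t by (simp add: power_mult_distrib mult_ac)
    moreover have "\<phi> ((1 - t) *\<^sub>R d) \<le> (1 - t) * \<phi> d + t * \<phi> 0"
      using convex_onD[OF convex, of t d 0] t d zero by simp
    moreover have "(1 - t)\<^sup>2 * (H / 2 * (norm d)\<^sup>2)
        = H / 2 * (norm d)\<^sup>2 - t * ((2 - t) * (H / 2 * (norm d)\<^sup>2))"
      by (simp add: field_simps power2_eq_square)
    ultimately have "t * (g \<bullet> d + (2 - t) * (H / 2 * (norm d)\<^sup>2) + \<phi> d) \<le> t * \<phi> 0"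
      by argo
    then show ?thesis using t by simp
  qed
  have "((\<lambda>t. g \<bullet> d + (2 - t) * (H / 2 * (norm d)\<^sup>2) + \<phi> d)
      \<longlongrightarrow> g \<bullet> d + (2 - 0) * (H / 2 * (norm d)\<^sup>2) + \<phi> d) (at_right 0)"
    by (intro tendsto_intros)
  moreover have "eventually (\<lambda>t::real. g \<bullet> d + (2 - t) * (H / 2 * (norm d)\<^sup>2) + \<phi> d \<le> \<phi> 0) (at_right 0)"
    unfolding eventually_at_right_field using * by (intro exI[of _ 1]) simp
  ultimately have "g \<bullet> d + (2 - 0) * (H / 2 * (norm d)\<^sup>2) + \<phi> d \<le> \<phi> 0"
    by (rule tendsto_upperbound) simp
  then show ?thesis by simp
qed

text \<open>Both values of \<open>cpg_H\<close> yield the same gain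
  \<open>(L j + \<eta> j) / 2\<close> times the squared step: the smaller one through
  \<open>convex_prox_step\<close>, the larger one by comparing the minimiser with the zero step. The
  \<open>L j\<close> part absorbs the error in \<open>block_descent\<close>, and the
  \<open>\<eta> j\<close> part is nonnegative.\<close>

lemma cpg_run_decreasing:
  fixes f \<psi> :: "real^'n \<Rightarrow> real"
  assumes f: "\<And>y. f differentiable (at y)"
    and lip: "coord_lipschitz_grad U b N L f"
    and eta: "\<And>j. j \<in> {1..N} \<Longrightarrow> \<eta> j > 0"
    and run: "cpg_run f \<psi> U b N L \<eta> is xs"
    and i: "is k \<in> {1..N}"
  shows "f (xs (Suc k)) + \<psi> (xs (Suc k)) \<le> f (xs k) + \<psi> (xs k)"
proof -
  define j x A H where "j = is k" and "x = xs k" and "A = block U b j" and "H = cpg_H U b N L \<eta> \<psi> j"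
  let ?g = "transpose A *v grad f x" and ?\<phi> = "\<lambda>d. \<psi> (x + A *v d)"
  have j: "j \<in> {1..N}" using i by (simp add: j_def)
  from run obtain d where
    d: "is_arg_min (\<lambda>d. f x + ?g \<bullet> d + H / 2 * (norm d)\<^sup>2 + ?\<phi> d) (\<lambda>d. d \<in> block_space b j) d"
    and step: "xs (Suc k) = x + A *v d"
    unfolding cpg_run_def Let_def j_def x_def A_def H_def by blast
  have dS: "d \<in> block_space b j"
    using d by (simp add: is_arg_min_def)
  have min: "?g \<bullet> d + H / 2 * (norm d)\<^sup>2 + ?\<phi> d \<le> ?g \<bullet> e + H / 2 * (norm e)\<^sup>2 + ?\<phi> e"
    if "e \<in> block_space b j" for e
    using d that by (force simp: is_arg_min_def not_less)
  have descent: "f (x + A *v d) \<le> f x + ?g \<bullet> d + L j / 2 * (norm d)\<^sup>2"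
    unfolding A_def by (rule block_descent[OF f lip j dS])
  have eta': "0 \<le> \<eta> j / 2 * (norm d)\<^sup>2"
    using eta[OF j] by simp
  have "f (x + A *v d) + \<psi> (x + A *v d) \<le> f x + \<psi> x"
  proof (cases "\<forall>x. \<forall>j\<in>{1..N}. convex_on (block_space b j) (\<lambda>d. \<psi> (x + block U b j *v d))")
    case True
    then have "H = (L j + \<eta> j) / 2"
      unfolding H_def cpg_H_def by (rule if_P)
    then have "H * (norm d)\<^sup>2 = L j / 2 * (norm d)\<^sup>2 + \<eta> j / 2 * (norm d)\<^sup>2"
      by (simp add: algebra_simps add_divide_distrib)
    moreover have "convex_on (block_space b j) ?\<phi>"
      using True j by (simp add: A_def)
    then have "?g \<bullet> d + H * (norm d)\<^sup>2 + ?\<phi> d \<le> ?\<phi> 0"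
      using convex_prox_step[OF _ dS zero_in_block_space min] by blast
    ultimately show ?thesis
      using descent eta' by simp
  next
    case False
    then have "H = L j + \<eta> j"
      unfolding H_def cpg_H_def by (rule if_not_P)
    then have "H / 2 * (norm d)\<^sup>2 = L j / 2 * (norm d)\<^sup>2 + \<eta> j / 2 * (norm d)\<^sup>2"
      by (simp add: algebra_simps add_divide_distrib)
    then show ?thesis
      using min[OF zero_in_block_space] descent eta' by (simp add: add_divide_distrib)
  qed
  then show ?thesis
    by (simp add: step x_def)
qed

section \<open>Finiteness of the set of CGD iterates\<close>

text \<open>With \<open>m \<ge> 2\<close> the top coefficient \<open>a\<close> cannot be cancelled
  by \<open>e\<close> or \<open>g\<close>, so the polynomial is nonzero whatever their
  signs.\<close>

lemma finite_roots_power_linear: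
  fixes a e g :: real
  assumes "a \<noteq> 0" "m \<ge> 2"
  shows "finite {\<alpha>. a * \<alpha> ^ m + e * \<alpha> = g}"
proof -
  let ?p = "monom a m + monom e 1 - [:g:]"
  have "coeff ?p m = a"
    using assms(2) by (simp add: coeff_eq_0)
  then have "?p \<noteq> 0" using assms(1) by (metis coeff_0)
  then have "finite {\<alpha>. poly ?p \<alpha> = 0}"
    by (rule poly_roots_finite)
  then show ?thesis by (simp add: poly_monom)
qed

text \<open>In Rules 1 to 3 the value \<open>HF\<close> is a function of the root
  \<open>\<alpha>\<close>, and positivity of \<open>L\<psi>\<close> or \<open>H\<psi>\<close> makes
  the leading coefficient nonzero. For arbitrary \<open>Hf\<close> and \<open>g\<close> the root may
  fail to be unique; finitely many candidates suffice.\<close>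

lemma finite_cgd_H:
  assumes "rule_assumption rule U b N H\<psi> p L\<psi> \<psi>"
  shows "finite {HF. cgd_H rule H\<psi> p L\<psi> \<psi> x0 x Hf g HF}"
proof (cases rule)
  case Rule1
  then have "L\<psi> / 6 \<noteq> 0" using assms by (auto simp: A5_def)
  from finite_roots_power_linear[OF this, of 2 "H\<psi> / 2 * norm x ^ p + Hf" g] show ?thesis
    unfolding Rule1 cgd_H.simps
    by (rule finite_surj[where f = "\<lambda>\<alpha>. H\<psi> / 2 * norm x ^ p + L\<psi> / 6 * \<alpha> + Hf"]) auto
next
  case Rule2
  then have "2 ^ (p - 1) * H\<psi> \<noteq> 0" "p + 1 \<ge> 2" using assms by (auto simp: A4_def)
  from finite_roots_power_linear[OF this, of "2 ^ (p - 1) * H\<psi> * norm x ^ p + Hf" g] show ?thesis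
    unfolding Rule2 cgd_H.simps
    by (rule finite_surj[where
          f = "\<lambda>\<alpha>. 2 ^ (p - 1) * H\<psi> * norm x ^ p + 2 ^ (p - 1) * H\<psi> * \<alpha> ^ p + Hf"]) auto
next
  case Rule3
  then have "L\<psi> / 6 \<noteq> 0" using assms by (auto simp: A5_def)
  from finite_roots_power_linear[OF this, of 2
      "L\<psi> / 2 * norm (x - x0) + 1 / 2 * op_norm (hess \<psi> x0) + Hf" g] show ?thesis
    unfolding Rule3 cgd_H.simps
    by (rule finite_surj[where f = "\<lambda>\<alpha>. L\<psi> / 2 * norm (x - x0)
          + 1 / 2 * op_norm (hess \<psi> x0) + L\<psi> / 6 * \<alpha> + Hf"]) auto
next
  case Rule4
  then show ?thesis by simp
qed

text \<open>The set collects the \<open>k\<close>-th points of all runs from \<open>x0\<close>, so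
  that one finite set serves every sample point at once. Each point has finitely many successors:
  one for each block and each admissible \<open>HF\<close>.\<close>

lemma finite_cgd_iterates:
  assumes "rule_assumption rule U b N H\<psi> p L\<psi> \<psi>"
  shows "finite {xs k |is xs. cgd_run rule H\<psi> p L\<psi> f \<psi> U b L \<eta> is xs \<and> xs 0 = x0 \<and> (\<forall>n. is n \<in> {1..N})}"
proof (induction k)
  case 0
  then show ?case by (rule finite_subset[of _ "{x0}"]) auto
next
  case (Suc k)
  let ?S = "\<lambda>k. {xs k |is xs. cgd_run rule H\<psi> p L\<psi> f \<psi> U b L \<eta> is xs \<and> xs 0 = x0 \<and> (\<forall>n. is n \<in> {1..N})}"
  let ?g = "\<lambda>j x. transpose (block U b j) *v grad (\<lambda>y. f y + \<psi> y) x"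
  \<comment> \<open>All one-step successors of \<open>?S k\<close>. The history of a run matters
    only through \<open>xs 0\<close>, which is fixed to \<open>x0\<close>.\<close>
  let ?T = "\<Union>x\<in>?S k. \<Union>j\<in>{1..N}. (\<lambda>HF. x + block U b j *v (- (1 / HF) *\<^sub>R ?g j x)) `
      {HF. cgd_H rule H\<psi> p L\<psi> \<psi> x0 x ((L j + \<eta> j) / 2) (norm (?g j x)) HF}"
  have "?S (Suc k) \<subseteq> ?T"
  proof
    fix y assume "y \<in> ?S (Suc k)"
    then obtain "is" xs where y: "y = xs (Suc k)" and xs: "cgd_run rule H\<psi> p L\<psi> f \<psi> U b L \<eta> is xs"
      "xs 0 = x0" "\<forall>n. is n \<in> {1..N}"
      by blast
    from xs(1,2) obtain HF where
      "cgd_H rule H\<psi> p L\<psi> \<psi> x0 (xs k) ((L (is k) + \<eta> (is k)) / 2) (norm (?g (is k) (xs k))) HF"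
      "y = xs k + block U b (is k) *v (- (1 / HF) *\<^sub>R ?g (is k) (xs k))"
      unfolding y cgd_run_def Let_def by blast
    moreover have "xs k \<in> ?S k" "is k \<in> {1..N}" using xs by auto
    ultimately show "y \<in> ?T" by blast
  qed
  moreover have "finite ?T"
    using Suc finite_cgd_H[OF assms] by blast
  ultimately show ?case by (rule finite_subset)
qed

section \<open>From conditional descent to the rate in expectation\<close>

text \<open>The probabilistic core, free of any algorithm: two-sided bounds on \<open>F\<close>
  along the process make the tower property available, and the expected decreases then
  telescope.\<close>

lemma (in prob_space) min_expected_descent:
  fixes x :: "nat \<Rightarrow> 'a \<Rightarrow> 'b::topological_space" and F G :: "'b \<Rightarrow> real"
  assumes x: "\<And>k. x k \<in> borel_measurable M"
    and F: "F \<in> borel_measurable borel" and G: "G \<in> borel_measurable borel" "\<And>y. 0 \<le> G y"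
    and init: "\<And>\<omega>. \<omega> \<in> space M \<Longrightarrow> x 0 \<omega> = x0"
    and lower: "\<And>y. m \<le> F y"
    and upper: "\<And>k. \<exists>B. \<forall>\<omega>\<in>space M. F (x k \<omega>) \<le> B"
    and C: "C > 0"
    and descent: "\<And>k. AE \<omega> in M. C * G (x k \<omega>) \<le> F (x k \<omega>)
      - real_cond_exp M (vimage_algebra (space M) (x k) borel) (\<lambda>\<omega>. F (x (Suc k) \<omega>)) \<omega>"
  shows "integrable M (\<lambda>\<omega>. G (x j \<omega>))"
    and "k \<ge> 1 \<Longrightarrow> Min ((\<lambda>j. expectation (\<lambda>\<omega>. G (x j \<omega>))) ` {0..k-1}) \<le> (F x0 - m) / (real k * C)"
proof -
  note [measurable] = x F G
  have int_F: "integrable M (\<lambda>\<omega>. F (x k \<omega>))" for k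
  proof -
    obtain B where B: "\<And>\<omega>. \<omega> \<in> space M \<Longrightarrow> F (x k \<omega>) \<le> B" using upper by blast
    have "\<bar>F (x k \<omega>)\<bar> \<le> \<bar>B\<bar> + \<bar>m\<bar>" if "\<omega> \<in> space M" for \<omega>
      using B[OF that] lower[of "x k \<omega>"] by linarith
    then show ?thesis
      by (intro integrable_const_bound[where B = "\<bar>B\<bar> + \<bar>m\<bar>"]) auto
  qed
  define E where "E k = real_cond_exp M (vimage_algebra (space M) (x k) borel) (\<lambda>\<omega>. F (x (Suc k) \<omega>))"
    for k
  have int_E: "integrable M (E k)" "expectation (E k) = expectation (\<lambda>\<omega>. F (x (Suc k) \<omega>))" for k
  proof -
    \<comment> \<open>Measurability of \<open>x k\<close> places the generated sigma-algebra inside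
      \<open>M\<close>; finiteness of \<open>M\<close> then gives the setting in which
      \<open>real_cond_exp\<close> preserves expectations.\<close>
    have "subalgebra M (vimage_algebra (space M) (x k) borel)"
      using x[of k] by (auto simp: subalgebra_def sets_vimage_algebra2 measurable_def)
    then interpret finite_measure_subalgebra M "vimage_algebra (space M) (x k) borel"
      by unfold_locales
    show "integrable M (E k)" "expectation (E k) = expectation (\<lambda>\<omega>. F (x (Suc k) \<omega>))"
      unfolding E_def using int_F by (rule real_cond_exp_int)+
  qed
  have descent': "AE \<omega> in M. C * G (x k \<omega>) \<le> F (x k \<omega>) - E k \<omega>" for k
    using descent by (simp add: E_def)
  \<comment> \<open>Integrability of \<open>G\<close> is a consequence of the descent inequality:
    \<open>C * G\<close> is nonnegative and dominated by an integrable difference.\<close>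
  have int_G: "integrable M (\<lambda>\<omega>. G (x k \<omega>))" for k
  proof -
    have "integrable M (\<lambda>\<omega>. C * G (x k \<omega>))"
    proof (rule Bochner_Integration.integrable_bound)
      show "integrable M (\<lambda>\<omega>. F (x k \<omega>) - E k \<omega>)"
        using int_F int_E by auto
      show "AE \<omega> in M. norm (C * G (x k \<omega>)) \<le> norm (F (x k \<omega>) - E k \<omega>)"
        using descent'[of k]
      proof eventually_elim
        case (elim \<omega>)
        moreover have "0 \<le> C * G (x k \<omega>)" using C G(2) by simp
        ultimately show ?case by simp
      qed
    qed measurable
    then show ?thesis using C by simp
  qed
  then show "integrable M (\<lambda>\<omega>. G (x j \<omega>))" .
  have step: "C * expectation (\<lambda>\<omega>. G (x k \<omega>))
      \<le> expectation (\<lambda>\<omega>. F (x k \<omega>)) - expectation (\<lambda>\<omega>. F (x (Suc k) \<omega>))" for k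
  proof -
    have "expectation (\<lambda>\<omega>. C * G (x k \<omega>)) \<le> expectation (\<lambda>\<omega>. F (x k \<omega>) - E k \<omega>)"
      using descent' int_F int_E int_G by (intro integral_mono_AE) auto
    then show ?thesis using int_F int_E by simp
  qed
  let ?a = "\<lambda>j. expectation (\<lambda>\<omega>. G (x j \<omega>))"
  assume k: "k \<ge> 1"
  \<comment> \<open>The minimum is at most the average over the \<open>k\<close> indices
    \<open>j < k\<close>.\<close>
  have "real k * Min (?a ` {0..k-1}) = (\<Sum>j<k. Min (?a ` {0..k-1}))"
    by simp
  also have "\<dots> \<le> (\<Sum>j<k. ?a j)"
    by (intro sum_mono Min_le) auto
  finally have "C * (real k * Min (?a ` {0..k-1})) \<le> C * (\<Sum>j<k. ?a j)"
    using C by simp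
  also have "\<dots> \<le> (\<Sum>j<k. expectation (\<lambda>\<omega>. F (x j \<omega>)) - expectation (\<lambda>\<omega>. F (x (Suc j) \<omega>)))"
    unfolding sum_distrib_left by (intro sum_mono step)
  also have "\<dots> = expectation (\<lambda>\<omega>. F (x 0 \<omega>)) - expectation (\<lambda>\<omega>. F (x k \<omega>))"
    by (rule sum_lessThan_telescope')
  also have "expectation (\<lambda>\<omega>. F (x 0 \<omega>)) = expectation (\<lambda>\<omega>. F x0)"
    by (rule Bochner_Integration.integral_cong) (simp_all add: init)
  also have "\<dots> = F x0"
    by (simp add: prob_space)
  also have "F x0 - expectation (\<lambda>\<omega>. F (x k \<omega>)) \<le> F x0 - m"
    using integral_ge_const[OF int_F, of m k] lower by simp
  finally show "Min (?a ` {0..k-1}) \<le> (F x0 - m) / (real k * C)"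
    using k C by (simp add: field_simps)
qed

section \<open>Application to CPG and CGD\<close>

theorem mainTheorem7:
  fixes f \<psi> F :: "real^'n \<Rightarrow> real"
    and U :: "real^'n^'n" and b :: "'n \<Rightarrow> nat" and N :: nat
    and L \<eta> :: "nat \<Rightarrow> real" and H\<psi> L\<psi> :: real and p :: nat
    and Fstar C :: real
    and M :: "'w measure"
    and i :: "nat \<Rightarrow> 'w \<Rightarrow> nat" and x :: "nat \<Rightarrow> 'w \<Rightarrow> real^'n" and x0 :: "real^'n"
    and k :: nat
  assumes F: "F = (\<lambda>y. f y + \<psi> y)"
    and U: "column_permutation_of_id U"
    and blocks: "b ` UNIV \<subseteq> {1..N}"
    and f_diff: "\<forall>y. f differentiable (at y)"
    and A1: "coord_lipschitz_grad U b N L f"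
    and A2: "twice_cont_differentiable \<psi>"
    and A3: "\<exists>xstar. F xstar = Fstar \<and> (\<forall>y. Fstar \<le> F y)"
    and eta_pos: "\<forall>j\<in>{1..N}. \<eta> j > 0"
    and M: "prob_space M"
    and x_measurable: "\<forall>k. x k \<in> borel_measurable M"
    and indices: "uniform_indices M N i x"
    and x_init: "\<forall>\<omega>\<in>space M. x 0 \<omega> = x0"
    and algorithm:
      "(\<forall>\<omega>\<in>space M. cpg_run f \<psi> U b N L \<eta> (\<lambda>k. i k \<omega>) (\<lambda>k. x k \<omega>)) \<or>
       (\<exists>rule. rule_assumption rule U b N H\<psi> p L\<psi> \<psi> \<and>
          (\<forall>\<omega>\<in>space M. cgd_run rule H\<psi> p L\<psi> f \<psi> U b L \<eta> (\<lambda>k. i k \<omega>) (\<lambda>k. x k \<omega>)))"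
    and C_pos: "C > 0"
    and descent:
      "\<forall>k. AE \<omega> in M.
         F (x k \<omega>)
           - real_cond_exp M (vimage_algebra (space M) (x k) borel) (\<lambda>\<omega>. F (x (Suc k) \<omega>)) \<omega>
         \<ge> C * (norm (grad F (x k \<omega>)))\<^sup>2"
    and k: "k \<ge> 1"
  shows "(\<forall>j\<in>{0..k-1}. integrable M (\<lambda>\<omega>. (norm (grad F (x j \<omega>)))\<^sup>2)) \<and>
         Min ((\<lambda>j. integral\<^sup>L M (\<lambda>\<omega>. (norm (grad F (x j \<omega>)))\<^sup>2)) ` {0..k-1})
           \<le> (F x0 - Fstar) / (real k * C)"
proof -
  interpret prob_space M by (rule M)
  have F_diff: "F differentiable (at y)" for y
    unfolding F using f_diff A2 by (auto simp: twice_cont_differentiable_def)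
  have F_meas: "F \<in> borel_measurable borel"
    using F_diff by (intro borel_measurable_continuous_onI)
      (auto simp: continuous_on_eq_continuous_at intro: differentiable_imp_continuous_within)
  have G_meas: "(\<lambda>y. (norm (grad F y))\<^sup>2) \<in> borel_measurable borel"
    using borel_measurable_grad[OF F_diff] by measurable
  \<comment> \<open>This holds at every sample point, not just almost surely, since the target space
    of the measurable map \<open>i j\<close> is \<open>{1..N}\<close> itself.\<close>
  have i_range: "i j \<omega> \<in> {1..N}" if "\<omega> \<in> space M" for j \<omega>
    using indices that unfolding uniform_indices_def by (auto dest!: measurable_space)
  have upper: "\<exists>B. \<forall>\<omega>\<in>space M. F (x j \<omega>) \<le> B" for j
    using algorithm
  proof (elim disjE exE conjE)
    assume run: "\<forall>\<omega>\<in>space M. cpg_run f \<psi> U b N L \<eta> (\<lambda>k. i k \<omega>) (\<lambda>k. x k \<omega>)"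
    have "F (x j \<omega>) \<le> F x0" if \<omega>: "\<omega> \<in> space M" for \<omega>
    proof (induction j)
      case 0
      then show ?case using x_init \<omega> by simp
    next
      case (Suc j)
      have "F (x (Suc j) \<omega>) \<le> F (x j \<omega>)"
        unfolding F using cpg_run_decreasing[OF _ A1 _ bspec[OF run \<omega>], of j]
          f_diff eta_pos i_range[OF \<omega>] by blast
      with Suc show ?case by simp
    qed
    then show ?thesis by blast
  next
    fix rule
    assume rule: "rule_assumption rule U b N H\<psi> p L\<psi> \<psi>"
      and run: "\<forall>\<omega>\<in>space M. cgd_run rule H\<psi> p L\<psi> f \<psi> U b L \<eta> (\<lambda>k. i k \<omega>) (\<lambda>k. x k \<omega>)"
    \<comment> \<open>This set does not mention \<open>\<omega>\<close>, so the maximum of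
      \<open>F\<close> over it is a uniform bound.\<close>
    let ?S = "{xs j |is xs. cgd_run rule H\<psi> p L\<psi> f \<psi> U b L \<eta> is xs \<and> xs 0 = x0 \<and> (\<forall>n. is n \<in> {1..N})}"
    have "x j \<omega> \<in> ?S" if \<omega>: "\<omega> \<in> space M" for \<omega>
      unfolding mem_Collect_eq using bspec[OF run \<omega>] i_range[OF \<omega>] x_init \<omega>
      by (intro exI[of _ "\<lambda>k. i k \<omega>"] exI[of _ "\<lambda>k. x k \<omega>"]) blast
    moreover have "finite (F ` ?S)"
      using finite_cgd_iterates[OF rule] by (rule finite_imageI)
    ultimately have "\<forall>\<omega>\<in>space M. F (x j \<omega>) \<le> Max (F ` ?S)"
      by (intro ballI Max_ge) auto
    then show ?thesis by blast
  qed
  have lower: "Fstar \<le> F y" for y using A3 by blast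
  note rate = min_expected_descent[where x = x and F = F and G = "\<lambda>y. (norm (grad F y))\<^sup>2",
      OF x_measurable[rule_format] F_meas G_meas _ x_init[rule_format] lower upper C_pos
        descent[rule_format]]
  show ?thesis
    using rate(1) rate(2)[OF _ _ k] by simp
qed

end
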